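(* Let $0<\gamma_0<\gamma_1<\cdots<\gamma_p$ and $\epsilon>0$ be given, and let $(W^*(\gamma_0),W^*(\gamma_1),\ldots,W^*(\gamma_p))$ be a solution path generated by the adaptive sieving algorithm (described in the context) with these inputs. Then $W^*(\gamma_0),\ldots,W^*(\gamma_p)$ are approximate optimal solutions of the problems $$({\rm P}_{\gamma_k})\qquad \min_{W\in\mathbb{R}^{d\times n}}\ \frac12\|y-\mathcal{X}(W)\|^2+\chi_{\Omega_{\gamma_k}}(W),\qquad k=0,1,\ldots,p,$$ in the sense that $$\|R_{\gamma_k}(W^*(\gamma_k))\|_F\le\epsilon,\qquad k=0,1,\ldots,p.$$
   Context: **Setting.** Let $d,n,m_1,\dots,m_n$ be positive integers, $m=\sum_{i=1}^n m_i$. For $i=1,\dots,n$ let $X^i\in\mathbb{R}^{m_i\times d}$ and $\hat y^i\in\mathbb{R}^{m_i}$ be given, and let $y=[\hat y^1;\ldots;\hat y^n]\in\mathbb{R}^m$. The linear operator $\mathcal{X}:\mathbb{R}^{d\times n}\to\mathbb{R}^m$ is $\mathcal{X}(W)=[X^1\hat w^1;\ldots;X^n\hat w^n]$, where $\hat w^i$ is the $i$-th column of $W$; $\mathcal{X}^*$ is its adjoint. For $W\in\mathbb{R}^{d\times n}$, $\|W\|_{1,\infty}=\sum_{j=1}^d\max_{1\le i\le n}|W_{ji}|$. For $\gamma>0$, $\Omega_\gamma=\{W\in\mathbb{R}^{d\times n}:\|W\|_{1,\infty}\le\gamma\}$, $\chi_{\Omega_\gamma}$ is its indicator function ($0$ on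 $\Omega_\gamma$, $+\infty$ elsewhere), and $\partial\chi_{\Omega_\gamma}$ is the convex subdifferential. ${\rm Prox}_f(V)={\rm arg\,min}_Y\{\frac12\|Y-V\|_F^2+f(Y)\}$. The proximal residual function is $$R_\gamma(W):=W-{\rm Prox}_{\chi_{\Omega_\gamma}}\big(W-\mathcal{X}^*(\mathcal{X}W-y)\big).$$ For an index set $I\subseteq\{1,\ldots,d\}\times\{1,\ldots,n\}$, $\bar I$ denotes its complement and $W_I$ the collection of entries of $W$ indexed by $I$. $\mathbb{B}_\infty$ is the unit ball of the entrywise infinity norm in $\mathbb{R}^{d\times n}$, and for a set $\mathcal{P}\subseteq\mathbb{R}^{d\times n}$, $(\mathcal{P})_{ij}$ is the projection of $\mathcal{P}$ onto the $(i,j)$-th coordinate. **Adaptive sieving algorithm.** Input: $0<\gamma_0<\cdots<\gamma_p$ and tolerance $\epsilon>0$. Output: $W^*(\gamma_0),\ldots,W^*(\gamma_p)$. 1. Initialization: find $$W^*(\gamma_0)\in{\rm arg\,min}_{W\in\mathbb{R}^{d\times n}}\Big\{\tfrac12\|y-\mathcal{X}(W)\|^2+\chi_{\Omega_{\gamma_0}}(W)-\langle\Delta_0,W\rangle\Big\},$$ where $\Delta_0\in\mathbb{R}^{d\times n}$ is some error matrix with $\|\Delta_0\|_F\le\epsilon/\sqrt2$. Let $I^*(\gamma_0)=\{(i,j):(W^*(\gamma_0))_{ij}\ne0\}$. 2. For $k=1,\ldots,p$: (a) Let $I^0(\gamma_k)=I^*(\gamma_{k-1})$ and find $$W^0(\gamma_k)\in{\rm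 arg\,min}_{W\in\mathbb{R}^{d\times n}}\Big\{\tfrac12\|y-\mathcal{X}(W)\|^2+\chi_{\Omega_{\gamma_k}}(W)-\langle\Delta_k^0,W\rangle \ :\ W_{\bar I^0(\gamma_k)}=0\Big\},$$ where $\Delta_k^0$ is some error matrix with $\|\Delta_k^0\|_F\le\epsilon/\sqrt2$ and $(\Delta_k^0)_{\bar I^0(\gamma_k)}=0$. Compute $R_{\gamma_k}(W^0(\gamma_k))$ and set $l=0$. (b) While $\|R_{\gamma_k}(W^l(\gamma_k))\|_F>\epsilon$: form $$J^{l+1}(\gamma_k)=\Big\{(i,j)\in\bar I^l(\gamma_k):\ \big(\mathcal{X}^*(y-\mathcal{X}W^l(\gamma_k))\big)_{ij}\notin\Big(\partial\chi_{\Omega_{\gamma_k}}(W^l(\gamma_k))+\frac{\epsilon}{\sqrt{2|\bar I^l(\gamma_k)|}}\mathbb{B}_\infty\Big)_{ij}\Big\},$$ set $I^{l+1}(\gamma_k)=I^l(\gamma_k)\cup J^{l+1}(\gamma_k)$, and find $$W^{l+1}(\gamma_k)\in{\rm arg\,min}_{W\in\mathbb{R}^{d\times n}}\Big\{\tfrac12\|y-\mathcal{X}(W)\|^2+\chi_{\Omega_{\gamma_k}}(W)-\langle\Delta_k^{l+1},W\rangle \ :\ W_{\bar I^{l+1}(\gamma_k)}=0\Big\},$$ where $\Delta_k^{l+1}$ is some error matrix with $\|\Delta_k^{l+1}\|_F\le\epsilon/\sqrt2$ and $(\Delta_k^{l+1})_{\bar I^{l+1}(\gamma_k)}=0$; compute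 $R_{\gamma_k}(W^{l+1}(\gamma_k))$ and replace $l$ by $l+1$. (c) When the while loop ends, set $W^*(\gamma_k)=W^l(\gamma_k)$ and $I^*(\gamma_k)=I^l(\gamma_k)$. *)

theory Defs
  imports "HOL-Analysis.Analysis"
begin

text \<open>
  Matrices in \<open>d \<times> n\<close> have type \<open>real^'n^'d\<close>; \<^const>\<open>norm\<close> and \<^const>\<open>inner\<close> on this type are the
  Frobenius norm and the trace inner product.

  The block sizes \<open>m\<^sub>i\<close> depend on \<open>i\<close>, so the stacked space of dimension \<open>m\<^sub>1 + \<dots> + m\<^sub>n\<close> is \<open>real^'m\<close>
  for an index type \<open>'m\<close> with a bijection \<open>pos\<close> from \<open>'m\<close> onto the pairs \<open>(i, r)\<close> with \<open>r < m i\<close>: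
  coordinate \<open>s\<close> of a stacked vector is entry \<open>r\<close> of block \<open>i\<close>, where \<open>pos s = (i, r)\<close>.
  The vector \<open>X i r\<close> is row \<open>r\<close> of the \<open>i\<close>-th data matrix.
\<close>

definition stacking :: "('n \<Rightarrow> nat) \<Rightarrow> ('m \<Rightarrow> 'n \<times> nat) \<Rightarrow> bool" where
  "stacking m pos \<longleftrightarrow> bij_betw pos UNIV (SIGMA i:UNIV. {..<m i})"

definition stack_vec :: "('m \<Rightarrow> 'n \<times> nat) \<Rightarrow> ('n \<Rightarrow> nat \<Rightarrow> real) \<Rightarrow> real^'m" where
  "stack_vec pos yhat = (\<chi> s. case pos s of (i, r) \<Rightarrow> yhat i r)"

definition stack_op ::
    "('m \<Rightarrow> 'n \<times> nat) \<Rightarrow> ('n \<Rightarrow> nat \<Rightarrow> real^'d) \<Rightarrow> real^'n^'d \<Rightarrow> real^'m" where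
  "stack_op pos X W = stack_vec pos (\<lambda>i r. X i r \<bullet> column i W)"

definition norm_1_inf :: "real^'n^'d \<Rightarrow> real" where
  "norm_1_inf W = (\<Sum>j\<in>UNIV. Max (range (\<lambda>i. \<bar>W $ j $ i\<bar>)))"

definition Omega :: "real \<Rightarrow> (real^'n^'d) set" where
  "Omega \<gamma> = {W. norm_1_inf W \<le> \<gamma>}"

definition indicator_fun :: "'a set \<Rightarrow> 'a \<Rightarrow> ereal" where
  "indicator_fun S x = (if x \<in> S then 0 else \<infinity>)"

definition subdifferential :: "('a::real_inner \<Rightarrow> ereal) \<Rightarrow> 'a \<Rightarrow> 'a set" where
  "subdifferential f x = {g. \<forall>z. f x + ereal (g \<bullet> (z - x)) \<le> f z}"

definition Prox :: "('a::real_normed_vector \<Rightarrow> ereal) \<Rightarrow> 'a \<Rightarrow> 'a" where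
  "Prox f v = arg_min (\<lambda>z. ereal (1/2 * (norm (z - v))\<^sup>2) + f z) (\<lambda>_. True)"

definition prox_residual ::
    "(real^'n^'d \<Rightarrow> real^'m) \<Rightarrow> real^'m \<Rightarrow> real \<Rightarrow> real^'n^'d \<Rightarrow> real^'n^'d" where
  "prox_residual A y \<gamma> W =
     W - Prox (indicator_fun (Omega \<gamma>)) (W - adjoint A (A W - y))"

text \<open>
  Index sets are sets of pairs (row, column). \<open>supported_on I W\<close> says that the entries of \<open>W\<close>
  outside \<open>I\<close> vanish.
\<close>

definition supported_on :: "('d \<times> 'n) set \<Rightarrow> real^'n^'d \<Rightarrow> bool" where
  "supported_on I W \<longleftrightarrow> (\<forall>(j, i) \<in> - I. W $ j $ i = 0)"

definition support :: "real^'n^'d \<Rightarrow> ('d \<times> 'n) set" where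
  "support W = {(j, i). W $ j $ i \<noteq> 0}"

definition coord_proj :: "(real^'n^'d) set \<Rightarrow> 'd \<Rightarrow> 'n \<Rightarrow> real set" where
  "coord_proj P j i = (\<lambda>G. G $ j $ i) ` P"

definition perturbed_objective ::
    "(real^'n^'d \<Rightarrow> real^'m) \<Rightarrow> real^'m \<Rightarrow> real \<Rightarrow> real^'n^'d \<Rightarrow> real^'n^'d \<Rightarrow> ereal" where
  "perturbed_objective A y \<gamma> \<Delta> W =
     ereal (1/2 * (norm (y - A W))\<^sup>2) + indicator_fun (Omega \<gamma>) W - ereal (\<Delta> \<bullet> W)"

definition reduced_solution ::
    "(real^'n^'d \<Rightarrow> real^'m) \<Rightarrow> real^'m \<Rightarrow> real \<Rightarrow> real \<Rightarrow> ('d \<times> 'n) set \<Rightarrow> real^'n^'d \<Rightarrow> bool" where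
  "reduced_solution A y \<epsilon> \<gamma> I W \<longleftrightarrow>
     (\<exists>\<Delta>. norm \<Delta> \<le> \<epsilon> / sqrt 2 \<and> supported_on I \<Delta> \<and>
          is_arg_min (perturbed_objective A y \<gamma> \<Delta>) (supported_on I) W)"

text \<open>
  \<^const>\<open>infnorm\<close> on \<open>real^'n^'d\<close> is the entrywise infinity norm, and \<open>+\<close> is the Minkowski sum.
\<close>

definition sieve_new ::
    "(real^'n^'d \<Rightarrow> real^'m) \<Rightarrow> real^'m \<Rightarrow> real \<Rightarrow> real \<Rightarrow> ('d \<times> 'n) set \<Rightarrow> real^'n^'d
      \<Rightarrow> ('d \<times> 'n) set" where
  "sieve_new A y \<epsilon> \<gamma> I W =
     {(j, i) \<in> - I.
        adjoint A (y - A W) $ j $ i \<notin>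
          coord_proj
            (subdifferential (indicator_fun (Omega \<gamma>)) W
               + (\<lambda>B. (\<epsilon> / sqrt (2 * real (card (- I)))) *\<^sub>R B) ` {B. infnorm B \<le> 1}) j i}"

text \<open>
  Big-step semantics of the while loop: \<open>sieve_loop A y \<epsilon> \<gamma> I W I' W'\<close> says that some run of the
  loop entered in state \<open>(I, W)\<close> terminates in state \<open>(I', W')\<close>. It is a relation because neither
  the error matrices nor the minimizers of the reduced problems are determined by the input.
\<close>

inductive sieve_loop ::
    "(real^'n^'d \<Rightarrow> real^'m) \<Rightarrow> real^'m \<Rightarrow> real \<Rightarrow> real
      \<Rightarrow> ('d \<times> 'n) set \<Rightarrow> real^'n^'d \<Rightarrow> ('d \<times> 'n) set \<Rightarrow> real^'n^'d \<Rightarrow> bool"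
  for A y \<epsilon> \<gamma> where
  exit: "\<not> norm (prox_residual A y \<gamma> W) > \<epsilon> \<Longrightarrow> sieve_loop A y \<epsilon> \<gamma> I W I W"
| iterate: "norm (prox_residual A y \<gamma> W) > \<epsilon>
    \<Longrightarrow> I1 = I \<union> sieve_new A y \<epsilon> \<gamma> I W
    \<Longrightarrow> reduced_solution A y \<epsilon> \<gamma> I1 W1
    \<Longrightarrow> sieve_loop A y \<epsilon> \<gamma> I1 W1 I' W'
    \<Longrightarrow> sieve_loop A y \<epsilon> \<gamma> I W I' W'"

definition sieve_init ::
    "(real^'n^'d \<Rightarrow> real^'m) \<Rightarrow> real^'m \<Rightarrow> real \<Rightarrow> real \<Rightarrow> real^'n^'d \<Rightarrow> bool" where
  "sieve_init A y \<epsilon> \<gamma> W \<longleftrightarrow>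
     (\<exists>\<Delta>. norm \<Delta> \<le> \<epsilon> / sqrt 2 \<and> is_arg_min (perturbed_objective A y \<gamma> \<Delta>) (\<lambda>_. True) W)"

text \<open>
  Only the values \<open>\<gamma> 0, \<dots>, \<gamma> p\<close> and \<open>W 0, \<dots>, W p\<close> matter; \<open>I k\<close> is the final index set for \<open>\<gamma> k\<close>.
\<close>

definition adaptive_sieving_path ::
    "(real^'n^'d \<Rightarrow> real^'m) \<Rightarrow> real^'m \<Rightarrow> real \<Rightarrow> nat \<Rightarrow> (nat \<Rightarrow> real)
      \<Rightarrow> (nat \<Rightarrow> real^'n^'d) \<Rightarrow> bool" where
  "adaptive_sieving_path A y \<epsilon> p \<gamma> W \<longleftrightarrow>
     (\<exists>I. sieve_init A y \<epsilon> (\<gamma> 0) (W 0) \<and> I 0 = support (W 0) \<and>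
        (\<forall>k\<in>{1..p}. \<exists>W0. reduced_solution A y \<epsilon> (\<gamma> k) (I (k - 1)) W0 \<and>
           sieve_loop A y \<epsilon> (\<gamma> k) (I (k - 1)) W0 (I k) (W k)))"

end

theory Submission
  imports Defs
begin

text \<open>
  When the while loop exits, its test says that the residual is at most \<open>\<epsilon>\<close>, so only
  \<open>k = 0\<close> needs an argument. There \<open>W\<close> minimizes the objective perturbed by \<open>\<Delta>\<close>, so
  \<open>(g - \<Delta>) \<bullet> (z - W) \<ge> 0\<close> on \<open>\<Omega>\<close> with \<open>g = \<X>\<^sup>* (\<X> W - y)\<close>. Adding this inequality for
  \<open>z = P (W - g)\<close> to the variational inequality characterizing the projection \<open>P (W - g)\<close>
  gives \<open>\<parallel>r\<parallel>\<^sup>2 \<le> \<Delta> \<bullet> r\<close> for the residual \<open>r\<close>, so \<open>\<parallel>r\<parallel> \<le> \<parallel>\<Delta>\<parallel> \<le> \<epsilon> / \<surd>2\<close>.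
\<close>

lemma linear_stack_op: "linear (stack_op pos X)"
  by (rule linearI)
    (auto simp: stack_op_def stack_vec_def vec_eq_iff column_def inner_vec_def
      algebra_simps sum.distrib sum_distrib_left split: prod.splits)

text \<open>A sum of row maxima is the maximum, over all choices \<sigma> of one column per row, of
  the sums of the chosen entries. This trades \<open>Max\<close> for a family of constraints that
  are continuous and convex in \<open>W\<close>, so closedness and convexity of \<open>Omega\<close>
  can be checked one \<sigma> at a time.\<close>

lemma mem_Omega_iff:
  fixes W :: "real^'n::finite^'d::finite"
  shows "W \<in> Omega \<gamma> \<longleftrightarrow> (\<forall>\<sigma>. (\<Sum>j\<in>UNIV. \<bar>W $ j $ \<sigma> j\<bar>) \<le> \<gamma>)"
proof
  assume W: "W \<in> Omega \<gamma>"
  show "\<forall>\<sigma>. (\<Sum>j\<in>UNIV. \<bar>W $ j $ \<sigma> j\<bar>) \<le> \<gamma>"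
  proof
    fix \<sigma> :: "'d \<Rightarrow> 'n"
    have "(\<Sum>j\<in>UNIV. \<bar>W $ j $ \<sigma> j\<bar>) \<le> norm_1_inf W"
      unfolding norm_1_inf_def by (intro sum_mono Max_ge) auto
    with W show "(\<Sum>j\<in>UNIV. \<bar>W $ j $ \<sigma> j\<bar>) \<le> \<gamma>"
      by (simp add: Omega_def)
  qed
next
  assume *: "\<forall>\<sigma>. (\<Sum>j\<in>UNIV. \<bar>W $ j $ \<sigma> j\<bar>) \<le> \<gamma>"
  \<comment> \<open>Each row maximum is attained because the row is finite and nonempty; choosing a
    maximizing column in every row gives the critical \<sigma>.\<close>
  have "Max (range (\<lambda>i. \<bar>W $ j $ i\<bar>)) \<in> range (\<lambda>i. \<bar>W $ j $ i\<bar>)" for j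
    by (rule Max_in) auto
  then have "\<exists>i. Max (range (\<lambda>i. \<bar>W $ j $ i\<bar>)) = \<bar>W $ j $ i\<bar>" for j
    by blast
  then obtain \<sigma> where "\<And>j. Max (range (\<lambda>i. \<bar>W $ j $ i\<bar>)) = \<bar>W $ j $ \<sigma> j\<bar>"
    by metis
  with * show "W \<in> Omega \<gamma>"
    by (simp add: Omega_def norm_1_inf_def)
qed

lemma closed_Omega: "closed (Omega \<gamma> :: (real^'n::finite^'d::finite) set)"
proof -
  have "Omega \<gamma> = (\<Inter>\<sigma>. {W :: real^'n^'d. (\<Sum>j\<in>UNIV. \<bar>W $ j $ \<sigma> j\<bar>) \<le> \<gamma>})"
    by (auto simp: mem_Omega_iff)
  also have "closed \<dots>"
    by (intro closed_INT ballI closed_Collect_le continuous_intros)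
  finally show ?thesis .
qed

lemma convex_Omega: "convex (Omega \<gamma> :: (real^'n::finite^'d::finite) set)"
proof (rule convexI)
  fix V W :: "real^'n^'d" and u v :: real
  assume VW: "V \<in> Omega \<gamma>" "W \<in> Omega \<gamma>" and uv: "0 \<le> u" "0 \<le> v" "u + v = 1"
  have "(\<Sum>j\<in>UNIV. \<bar>(u *\<^sub>R V + v *\<^sub>R W) $ j $ \<sigma> j\<bar>) \<le> \<gamma>" for \<sigma>
  proof -
    have "(\<Sum>j\<in>UNIV. \<bar>(u *\<^sub>R V + v *\<^sub>R W) $ j $ \<sigma> j\<bar>)
        \<le> (\<Sum>j\<in>UNIV. u * \<bar>V $ j $ \<sigma> j\<bar> + v * \<bar>W $ j $ \<sigma> j\<bar>)"
      using uv abs_triangle_ineq[of "u * V $ j $ \<sigma> j" "v * W $ j $ \<sigma> j" for j]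
      by (intro sum_mono) (simp add: abs_mult)
    also have "\<dots> = u * (\<Sum>j\<in>UNIV. \<bar>V $ j $ \<sigma> j\<bar>) + v * (\<Sum>j\<in>UNIV. \<bar>W $ j $ \<sigma> j\<bar>)"
      by (simp add: sum.distrib sum_distrib_left)
    also have "\<dots> \<le> \<gamma>"
      using VW uv by (intro convex_bound_le) (auto simp: mem_Omega_iff)
    finally show ?thesis .
  qed
  then show "u *\<^sub>R V + v *\<^sub>R W \<in> Omega \<gamma>"
    by (simp add: mem_Omega_iff)
qed

lemma zero_in_Omega: "0 \<le> \<gamma> \<Longrightarrow> 0 \<in> Omega \<gamma>"
  by (simp add: mem_Omega_iff)

text \<open>On \<open>S\<close> the objective is half the squared distance to \<open>v\<close>, and
  off \<open>S\<close> it is infinite. Since \<open>arg_min\<close> is a choice operator, it is not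
  enough that the closest point minimizes: it must be the only minimizer, which follows from
  convexity.\<close>

lemma Prox_indicator_fun:
  fixes S :: "'a::euclidean_space set"
  assumes S: "closed S" "convex S" "S \<noteq> {}"
  shows "Prox (indicator_fun S) v = closest_point S v"
proof -
  define c where "c = closest_point S v"
  define f where "f = (\<lambda>z. ereal (1/2 * (norm (z - v))\<^sup>2) + indicator_fun S z)"
  have c: "c \<in> S" and c_le: "\<And>z. z \<in> S \<Longrightarrow> dist v c \<le> dist v z"
    using closest_point_in_set closest_point_le S unfolding c_def by blast+
  have f_in: "f z = ereal (1/2 * (dist v z)\<^sup>2)" if "z \<in> S" for z
    using that by (simp add: f_def indicator_fun_def dist_norm norm_minus_commute)
  have f_out: "f z = \<infinity>" if "z \<notin> S" for z
    using that by (simp add: f_def indicator_fun_def)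
  have "f c \<le> f z" for z
    by (cases "z \<in> S") (auto simp: f_in f_out c intro!: power_mono c_le)
  moreover have "z = c" if z: "\<And>x. f z \<le> f x" for z
  proof -
    \<comment> \<open>The value at \<open>c\<close> is finite, so a minimizer cannot lie off
      \<open>S\<close>.\<close>
    have "z \<in> S"
      using z[of c] c by (cases "z \<in> S") (auto simp: f_in f_out)
    moreover have "dist v z \<le> dist v x" if "x \<in> S" for x
      using z[of x] that \<open>z \<in> S\<close> by (simp add: f_in power2_le_iff_abs_le)
    ultimately show "z = c"
      unfolding c_def by (intro closest_point_unique) (use S in auto)
  qed
  ultimately have "(SOME z. is_arg_min f (\<lambda>_. True) z) = c"
    by (intro some_equality) (auto simp: is_arg_min_def not_less)
  then show ?thesis
    by (simp add: Prox_def arg_min_def f_def c_def)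
qed

text \<open>This passes from extended to real values: the objective is finite at 0, which is
  feasible for nonnegative \<gamma>, hence also at the minimizer.\<close>

lemma perturbed_objective_minimizer:
  fixes A :: "real^'n::finite^'d::finite \<Rightarrow> real^'m::finite"
  assumes "0 \<le> \<gamma>" and min: "is_arg_min (perturbed_objective A y \<gamma> \<Delta>) (\<lambda>_. True) W"
  shows "W \<in> Omega \<gamma>"
    and "Z \<in> Omega \<gamma> \<Longrightarrow>
      1/2 * (norm (y - A W))\<^sup>2 - \<Delta> \<bullet> W \<le> 1/2 * (norm (y - A Z))\<^sup>2 - \<Delta> \<bullet> Z"
proof -
  have le: "perturbed_objective A y \<gamma> \<Delta> W \<le> perturbed_objective A y \<gamma> \<Delta> Z" for Z
    using min by (auto simp: is_arg_min_def not_less)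
  show W: "W \<in> Omega \<gamma>"
    using le[of 0] zero_in_Omega[OF \<open>0 \<le> \<gamma>\<close>]
    by (cases "W \<in> Omega \<gamma>") (auto simp: perturbed_objective_def indicator_fun_def split: if_splits)
  show "1/2 * (norm (y - A W))\<^sup>2 - \<Delta> \<bullet> W \<le> 1/2 * (norm (y - A Z))\<^sup>2 - \<Delta> \<bullet> Z"
    if "Z \<in> Omega \<gamma>"
    using le[of Z] that W by (simp add: perturbed_objective_def indicator_fun_def)
qed

text \<open>First-order optimality: restricted to the segment from \<open>w\<close> to
  \<open>z\<close>, the objective is a quadratic in \<open>t\<close> minimized at
  \<open>t = 0\<close>, so its right derivative there is nonnegative. That derivative is
  \<open>c\<close>.\<close>

lemma least_squares_variational_inequality:
  fixes A :: "'a::euclidean_space \<Rightarrow> 'b::euclidean_space"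
  assumes A: "linear A" and S: "convex S" "w \<in> S" "z \<in> S"
    and min: "\<And>x. x \<in> S \<Longrightarrow>
      1/2 * (norm (y - A w))\<^sup>2 - \<delta> \<bullet> w \<le> 1/2 * (norm (y - A x))\<^sup>2 - \<delta> \<bullet> x"
  shows "0 \<le> (adjoint A (A w - y) - \<delta>) \<bullet> (z - w)"
proof -
  define u where "u = z - w"
  define c where "c = (A w - y) \<bullet> A u - \<delta> \<bullet> u"
  \<comment> \<open>The right-hand side is the exact difference quotient of the objective between
    \<open>w\<close> and \<open>w + t *\<^sub>R u\<close>; letting \<open>t\<close> tend to 0 from
    the right leaves \<open>c\<close>.\<close>
  have ineq: "0 \<le> c + t * (1/2 * (A u \<bullet> A u))" if t: "0 < t" "t \<le> 1" for t
  proof -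
    have "w + t *\<^sub>R u = (1 - t) *\<^sub>R w + t *\<^sub>R z"
      by (simp add: u_def algebra_simps)
    also have "\<dots> \<in> S"
      using S t by (intro convexD) auto
    finally have "0 \<le> (1/2 * (norm (y - A (w + t *\<^sub>R u)))\<^sup>2 - \<delta> \<bullet> (w + t *\<^sub>R u))
        - (1/2 * (norm (y - A w))\<^sup>2 - \<delta> \<bullet> w)"
      using min by simp
    also have "\<dots> = t * (c + t * (1/2 * (A u \<bullet> A u)))"
      unfolding c_def power2_norm_eq_inner linear_add[OF A] linear_scale[OF A]
      by (simp add: inner_diff_left inner_diff_right inner_add_left inner_add_right
          inner_commute field_simps)
    finally show ?thesis
      using t by (simp add: zero_le_mult_iff)
  qed
  have "((\<lambda>t. c + t * (1/2 * (A u \<bullet> A u))) \<longlongrightarrow> c + 0 * (1/2 * (A u \<bullet> A u))) (at_right 0)"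
    by (intro tendsto_intros)
  moreover have "\<forall>\<^sub>F t in at_right 0. 0 \<le> c + t * (1/2 * (A u \<bullet> A u))"
    using ineq by (auto simp: eventually_at_right_field intro!: exI[of _ 1])
  ultimately have "0 \<le> c + 0 * (1/2 * (A u \<bullet> A u))"
    by (intro tendsto_lowerbound) auto
  then show ?thesis
    by (simp add: c_def u_def inner_diff_left adjoint_clauses[OF A])
qed

lemma norm_diff_closest_point_le:
  fixes S :: "'a::euclidean_space set"
  assumes S: "closed S" "convex S" and w: "w \<in> S"
    and vi: "\<And>z. z \<in> S \<Longrightarrow> 0 \<le> (g - \<delta>) \<bullet> (z - w)"
  shows "norm (w - closest_point S (w - g)) \<le> norm \<delta>"
proof -
  define q where "q = closest_point S (w - g)"
  have "q \<in> S"
    using closest_point_in_set S w unfolding q_def by blast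
  then have "0 \<le> (g - \<delta>) \<bullet> (q - w)"
    by (rule vi)
  \<comment> \<open>The obtuse-angle property of the projection of \<open>w - g\<close>, tested at
    the feasible point \<open>w\<close>.\<close>
  moreover have "(w - g - q) \<bullet> (w - q) \<le> 0"
    using closest_point_dot[OF S(2,1) w] unfolding q_def by blast
  ultimately have "(norm (w - q))\<^sup>2 \<le> \<delta> \<bullet> (w - q)"
    by (simp add: power2_norm_eq_inner inner_diff_left inner_diff_right)
  also have "\<dots> \<le> norm \<delta> * norm (w - q)"
    by (rule norm_cauchy_schwarz)
  finally have "norm (w - q) \<le> norm \<delta>"
    \<comment> \<open>The factor \<open>norm (w - q)\<close> can be cancelled only when it is
      nonzero; for \<open>w = q\<close> the bound is trivial.\<close>
    by (cases "w = q") (auto simp: power2_eq_square)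
  then show ?thesis
    by (simp add: q_def)
qed

lemma prox_residual_perturbed_minimizer:
  fixes A :: "real^'n::finite^'d::finite \<Rightarrow> real^'m::finite"
  assumes A: "linear A" and \<gamma>: "0 \<le> \<gamma>"
    and min: "is_arg_min (perturbed_objective A y \<gamma> \<Delta>) (\<lambda>_. True) W"
  shows "norm (prox_residual A y \<gamma> W) \<le> norm \<Delta>"
proof -
  note W = perturbed_objective_minimizer[OF \<gamma> min]
  have "norm (W - closest_point (Omega \<gamma>) (W - adjoint A (A W - y))) \<le> norm \<Delta>"
    by (intro norm_diff_closest_point_le closed_Omega convex_Omega W(1)
        least_squares_variational_inequality[OF A convex_Omega W(1) _ W(2)])
  moreover have "Omega \<gamma> \<noteq> ({} :: (real^'n^'d) set)"
    using W(1) by blast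
  ultimately show ?thesis
    by (simp add: prox_residual_def Prox_indicator_fun closed_Omega convex_Omega)
qed

text \<open>In the induction over the run, \<open>exit\<close> supplies the negated loop test and
  \<open>iterate\<close> leaves the final state unchanged.\<close>

lemma sieve_loop_residual_le:
  "sieve_loop A y \<epsilon> \<gamma> I W I' W' \<Longrightarrow> norm (prox_residual A y \<gamma> W') \<le> \<epsilon>"
  by (induction rule: sieve_loop.induct) auto

theorem theorem3p1:
  fixes m :: "'n::finite \<Rightarrow> nat"
    and pos :: "'m::finite \<Rightarrow> 'n \<times> nat"
    and X :: "'n \<Rightarrow> nat \<Rightarrow> real^'d::finite"
    and yhat :: "'n \<Rightarrow> nat \<Rightarrow> real"
    and p :: nat
    and \<gamma> :: "nat \<Rightarrow> real"
    and \<epsilon> :: real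
    and Wstar :: "nat \<Rightarrow> real^'n^'d"
  assumes "\<And>i. 0 < m i"
    and "stacking m pos"
    and "0 < \<gamma> 0"
    and "strict_mono_on {..p} \<gamma>"
    and "0 < \<epsilon>"
    and "adaptive_sieving_path (stack_op pos X) (stack_vec pos yhat) \<epsilon> p \<gamma> Wstar"
  shows "\<forall>k\<le>p. norm (prox_residual (stack_op pos X) (stack_vec pos yhat) (\<gamma> k) (Wstar k)) \<le> \<epsilon>"
proof (intro allI impI)
  let ?A = "stack_op pos X" and ?y = "stack_vec pos yhat"
  fix k assume "k \<le> p"
  from assms(6) obtain I where init: "sieve_init ?A ?y \<epsilon> (\<gamma> 0) (Wstar 0)"
    and loop: "\<And>k. k \<in> {1..p} \<Longrightarrow>
      \<exists>W0. sieve_loop ?A ?y \<epsilon> (\<gamma> k) (I (k - 1)) W0 (I k) (Wstar k)"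
    unfolding adaptive_sieving_path_def by blast
  show "norm (prox_residual ?A ?y (\<gamma> k) (Wstar k)) \<le> \<epsilon>"
  proof (cases "k = 0")
    case True
    from init obtain \<Delta> where \<Delta>: "norm \<Delta> \<le> \<epsilon> / sqrt 2"
      and min: "is_arg_min (perturbed_objective ?A ?y (\<gamma> 0) \<Delta>) (\<lambda>_. True) (Wstar 0)"
      unfolding sieve_init_def by blast
    have "norm (prox_residual ?A ?y (\<gamma> 0) (Wstar 0)) \<le> norm \<Delta>"
      using assms(3) by (intro prox_residual_perturbed_minimizer linear_stack_op min) simp
    also note \<Delta>
    \<comment> \<open>The denominator 1 is kept visible so that the bound is monotonicity of
      division, from 1 \<le> \<open>sqrt 2\<close>.\<close>
    also have "\<epsilon> / sqrt 2 \<le> \<epsilon> / 1"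
      using assms(5) by (intro divide_left_mono) auto
    finally show ?thesis
      using True by simp
  next
    case False
    with \<open>k \<le> p\<close> loop[of k] show ?thesis
      by (auto intro: sieve_loop_residual_le)
  qed
qed

end
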